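(* The translation procedure $\mathrm{toAINF}$ from Polara to $\mathrm{AINF}$ is terminating and type preserving. That is, the recursive equations given in the context terminate on every input, hence define a total function, and for every type $t$ and every well-typed Polara term $e:\mathrm{Tm}\,\mathrm{VPar}\,t$ of type $t$, the result $\mathrm{toAINF}\,e$ is an element of $\mathrm{AINF}\,t$, i.e. a well-typed $\mathrm{AINF}$ term of the same type $t$.
   Context: **Types.** $t ::= \mathsf{fin}\,n \mid \mathsf{flt} \mid t\,\hat\times\,t \mid t\,\hat\to\,t \mid n\,\hat\Rightarrow\,t$ with $n\in\mathbb N$. Let $\mathrm{Ty}$ be the set of types. Here $\mathsf{fin}\,n$ is the type of naturals below $n$, $\mathsf{flt}$ the type of floating point numbers, and $n\,\hat\Rightarrow\,t$ the type of arrays of length $n$ with entries of type $t$. $\mathbb F$ is a fixed set of floating point literals. **Constants and their typings** (the arrow $\to$ below separates arguments from the result; it is not the type former $\hat\to$): $k:\mathsf{fin}\,m$ for naturals $k<m$; $f:\mathsf{flt}$ for $f\in\mathbb F$; $\hat+,\hat\cdot,\hat-,\hat/:\mathsf{flt}\to\mathsf{flt}\to\mathsf{flt}$; $\hat+:\mathsf{fin}\,n\to\mathsf{fin}\,m\to\mathsf{fin}(n+m-1)$; $\mathsf{app}:(t_1\hat\to t_2)\to t_1\to t_2$; $\mathsf{get}:(n\hat\Rightarrow t)\to\mathsf{fin}\,n\to t$; $\mathsf{pair}:t_1\to t_2\to(t_1\hat\times t_2)$; $\mathsf{fst}:(t_1\hat\times t_2)\to t_1$; $\mathsf{snd}:(t_1\hat\times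 t_2)\to t_2$; $\mathsf{sum}:(n\hat\Rightarrow\mathsf{flt})\to\mathsf{flt}$. **Polara terms** (intrinsically typed, parametric higher-order abstract syntax). For $\Gamma:\mathrm{Ty}\to\mathrm{Type}$, the family $\mathrm{Tm}\,\Gamma\,t$ is inductively generated by: - $\mathsf{var}\,x:\mathrm{Tm}\,\Gamma\,t$ for $x:\Gamma\,t$; - $c\,\overline{e}:\mathrm{Tm}\,\Gamma\,t'$ for a constant $c:t_1\to\dots\to t_k\to t'$ and $e_j:\mathrm{Tm}\,\Gamma\,t_j$; - $\mathsf{fun}\,e:\mathrm{Tm}\,\Gamma\,(t_1\hat\to t_2)$ for $e:\Gamma\,t_1\to\mathrm{Tm}\,\Gamma\,t_2$; - $\mathsf{for}\,e:\mathrm{Tm}\,\Gamma\,(n\hat\Rightarrow t)$ for $e:\Gamma(\mathsf{fin}\,n)\to\mathrm{Tm}\,\Gamma\,t$; - $\mathsf{ite}\,e_1\,e_2\,e_3:\mathrm{Tm}\,\Gamma\,t$ for $e_1:\mathrm{Tm}\,\Gamma(\mathsf{fin}\,2)$ and $e_2,e_3:\mathrm{Tm}\,\Gamma\,t$ (a condition counts as true iff nonzero); - $\mathsf{let}\,e_1;e_2:\mathrm{Tm}\,\Gamma\,t_2$ for $e_1:\mathrm{Tm}\,\Gamma\,t_1$ and $e_2:\Gamma\,t_1\to\mathrm{Tm}\,\Gamma\,t_2$. **AINF (indexed administrative normal form)**, in intrinsically typed first-order syntax. For each type $t$, $\mathrm{Var}\,t=\{x_m^t: m\in\mathbb N\}$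 and $\mathrm{Par}\,t=\{i_m^t:m\in\mathbb N\}$ are sets of names tagged by $t$ (variables, resp. indices), and $\mathrm{VPar}\,t=\mathrm{Var}\,t\sqcup\mathrm{Par}\,t$ (atoms). Well-typedness of AINF refers to these type tags. - Primitives $\mathrm{Prim}\,t$: an atom $v:\mathrm{VPar}\,t$; $c\,\overline v:\mathrm{Prim}\,t'$ for a constant $c:t_1\to\dots\to t_k\to t'$ and $v_j:\mathrm{VPar}\,t_j$; $\mathsf{fun}\,i.\,v:\mathrm{Prim}(t_1\hat\to t_2)$ for $i:\mathrm{Par}\,t_1$, $v:\mathrm{VPar}\,t_2$; $\mathsf{for}\,i.\,v:\mathrm{Prim}(n\hat\Rightarrow t)$ for $i:\mathrm{Par}(\mathsf{fin}\,n)$, $v:\mathrm{VPar}\,t$; $\mathsf{ite}\,v_1\,v_2\,v_3:\mathrm{Prim}\,t$ for $v_1:\mathrm{VPar}(\mathsf{fin}\,2)$, $v_2,v_3:\mathrm{VPar}\,t$. - Scope contexts $C$ (set $\mathrm{Env}$): finite lists of entries of the forms $\mathsf{fun}\,i{:}t$ ($i:\mathrm{Par}\,t$), $\mathsf{for}\,i{:}n$ ($i:\mathrm{Par}(\mathsf{fin}\,n)$), $\mathsf{if}\,v{\neq}0$, $\mathsf{if}\,v{=}0$ ($v:\mathrm{VPar}(\mathsf{fin}\,2)$). Write $C[E]$ for $C$ extended by the innermost entry $E$. - $\mathrm{AINF}\,t$ is inductively generated by $\mathsf{ret}\,v$ for $v:\mathrm{VPar}\,t$, and $\mathsf{let}\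 C[x=p];\,a$ for $C:\mathrm{Env}$, $x:\mathrm{Var}\,t_1$, $p:\mathrm{Prim}\,t_1$, $a:\mathrm{AINF}\,t$ ($t_1$ any type). **Translation.** Put $\mathrm{Counter}(X)=\mathbb N\to X$ (the number is used only to generate fresh names; the particular naming scheme is immaterial). Smart binding: for $C:\mathrm{Env}$, $p:\mathrm{Prim}\,t_1$ and a continuation $k:\mathrm{VPar}\,t_1\to\mathrm{Counter}(\mathrm{AINF}\,t_2)$, define $(\!|p|\!)_C\,k:\mathrm{Counter}(\mathrm{AINF}\,t_2)$ by $((\!|v|\!)_C\,k)(m)=k\,v\,m$ if $p$ is an atom $v$, and $((\!|p|\!)_C\,k)(m)=\mathsf{let}\ C[x_m^{t_1}=p];\ k\,x_m^{t_1}\,(m+1)$ otherwise. For $C:\mathrm{Env}$, $e:\mathrm{Tm}\,\mathrm{VPar}\,t_1$ and $k:\mathrm{VPar}\,t_1\to\mathrm{Counter}(\mathrm{AINF}\,t_2)$, define $C\llbracket e\rrbracket\,k:\mathrm{Counter}(\mathrm{AINF}\,t_2)$ by recursion on $e$: - $C\llbracket\mathsf{var}\,v\rrbracket\,k=(\!|v|\!)_C\,k$; - $C\llbracket c\,e_1\cdots e_l\rrbracket\,k=C\llbracket e_1\rrbracket\,\lambda v_1.\ \cdots\ C\llbracket e_l\rrbracket\,\lambda v_l.\ (\!|c\,v_1\cdots v_l|\!)_C\,k$; - $(C\llbracket\mathsf{fun}\,e\rrbracket\,k)(m)=\big(C[\mathsf{fun}\,i{:}t]\llbracket e\,i\rrbracket\,\lambda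 v.\ (\!|\mathsf{fun}\,i.\,v|\!)_C\,k\big)(m+1)$, where $t$ is the argument type and $i=i_m^{t}$; - $(C\llbracket\mathsf{for}\,e\rrbracket\,k)(m)=\big(C[\mathsf{for}\,i{:}n]\llbracket e\,i\rrbracket\,\lambda v.\ (\!|\mathsf{for}\,i.\,v|\!)_C\,k\big)(m+1)$, where $n$ is the array length and $i=i_m^{\mathsf{fin}\,n}$; - $C\llbracket\mathsf{ite}\,e_1\,e_2\,e_3\rrbracket\,k=C\llbracket e_1\rrbracket\,\lambda v_1.\ C[\mathsf{if}\,v_1{\neq}0]\llbracket e_2\rrbracket\,\lambda v_2.\ C[\mathsf{if}\,v_1{=}0]\llbracket e_3\rrbracket\,\lambda v_3.\ (\!|\mathsf{ite}\,v_1\,v_2\,v_3|\!)_C\,k$; - $C\llbracket\mathsf{let}\,e_1;e_2\rrbracket\,k=C\llbracket e_1\rrbracket\,\lambda v_1.\ C\llbracket e_2\,v_1\rrbracket\,k$. Finally $\mathrm{toAINF}\,e=(C_0\llbracket e\rrbracket\,k_0)(0)$ with $C_0$ the empty scope context and $k_0\,v\,m=\mathsf{ret}\,v$. *)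

theory Defs
  imports Main
begin

section \<open>Types and constants\<close>

datatype ty =
    Fin nat
  | Flt
  | Prod ty ty
  | Arrow ty ty
  | Array nat ty

text \<open>
  The type variable \<open>'f\<close> is the set of floating point literals. Constants carry
  the type indices at which they are used, so that a constant has exactly one signature.
\<close>

datatype 'f const =
    NatLit nat nat  \<comment> \<open>\<open>NatLit m k\<close> is the literal \<open>k : fin m\<close>\<close>
  | FltLit 'f
  | FAdd | FMul | FSub | FDiv
  | FinAdd nat nat
  | App ty ty
  | Get nat ty
  | Pair ty ty
  | Fst ty ty
  | Snd ty ty
  | Sum nat

fun const_args :: "'f const \<Rightarrow> ty list" where
  "const_args (NatLit m k) = []"
| "const_args (FltLit f) = []"
| "const_args FAdd = [Flt, Flt]"
| "const_args FMul = [Flt, Flt]"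
| "const_args FSub = [Flt, Flt]"
| "const_args FDiv = [Flt, Flt]"
| "const_args (FinAdd n m) = [Fin n, Fin m]"
| "const_args (App t1 t2) = [Arrow t1 t2, t1]"
| "const_args (Get n t) = [Array n t, Fin n]"
| "const_args (Pair t1 t2) = [t1, t2]"
| "const_args (Fst t1 t2) = [Prod t1 t2]"
| "const_args (Snd t1 t2) = [Prod t1 t2]"
| "const_args (Sum n) = [Array n Flt]"

text \<open>
  In the clause for \<open>FinAdd\<close>, subtraction truncates: \<open>n + m - 1\<close> is \<open>0\<close> if \<open>n = m = 0\<close>.
\<close>

fun const_res :: "'f const \<Rightarrow> ty" where
  "const_res (NatLit m k) = Fin m"
| "const_res (FltLit f) = Flt"
| "const_res FAdd = Flt"
| "const_res FMul = Flt"
| "const_res FSub = Flt"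
| "const_res FDiv = Flt"
| "const_res (FinAdd n m) = Fin (n + m - 1)"
| "const_res (App t1 t2) = t2"
| "const_res (Get n t) = t"
| "const_res (Pair t1 t2) = Prod t1 t2"
| "const_res (Fst t1 t2) = t1"
| "const_res (Snd t1 t2) = t2"
| "const_res (Sum n) = Flt"

fun const_ok :: "'f const \<Rightarrow> bool" where
  "const_ok (NatLit m k) \<longleftrightarrow> k < m"
| "const_ok _ \<longleftrightarrow> True"

definition const_typing :: "'f const \<Rightarrow> ty list \<Rightarrow> ty \<Rightarrow> bool" where
  "const_typing c ts t \<longleftrightarrow> const_ok c \<and> const_args c = ts \<and> const_res c = t"


section \<open>Polara terms\<close>

text \<open>
  Parametric higher-order abstract syntax over a type \<open>'v\<close> of variables. The intrinsically
  typed family is carved out of the raw terms by a typing relation. A family \<open>\<Gamma>\<close> assigns to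
  each type a set of variables; the body of a binder of type \<open>t\<close> is a function on all of
  \<open>'v\<close>, but only its values on \<open>\<Gamma> t\<close> are constrained. The annotations on \<open>TFun\<close> and
  \<open>TFor\<close> are the type, respectively the array length, of the bound variable.
\<close>

datatype ('f, 'v) tm =
    TVar 'v
  | TConst "'f const" "('f, 'v) tm list"
  | TFun ty "'v \<Rightarrow> ('f, 'v) tm"
  | TFor nat "'v \<Rightarrow> ('f, 'v) tm"
  | TIte "('f, 'v) tm" "('f, 'v) tm" "('f, 'v) tm"
  | TLet "('f, 'v) tm" "'v \<Rightarrow> ('f, 'v) tm"

inductive has_type :: "(ty \<Rightarrow> 'v set) \<Rightarrow> ('f, 'v) tm \<Rightarrow> ty \<Rightarrow> bool"
  for \<Gamma> :: "ty \<Rightarrow> 'v set" where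
  Var: "x \<in> \<Gamma> t \<Longrightarrow> has_type \<Gamma> (TVar x) t"
| Const: "\<lbrakk>const_typing c ts t'; list_all2 (has_type \<Gamma>) es ts\<rbrakk>
    \<Longrightarrow> has_type \<Gamma> (TConst c es) t'"
| Fun: "(\<And>x. x \<in> \<Gamma> t1 \<Longrightarrow> has_type \<Gamma> (e x) t2)
    \<Longrightarrow> has_type \<Gamma> (TFun t1 e) (Arrow t1 t2)"
| For: "(\<And>x. x \<in> \<Gamma> (Fin n) \<Longrightarrow> has_type \<Gamma> (e x) t)
    \<Longrightarrow> has_type \<Gamma> (TFor n e) (Array n t)"
| Ite: "\<lbrakk>has_type \<Gamma> e1 (Fin 2); has_type \<Gamma> e2 t; has_type \<Gamma> e3 t\<rbrakk>
    \<Longrightarrow> has_type \<Gamma> (TIte e1 e2 e3) t"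
| Let: "\<lbrakk>has_type \<Gamma> e1 t1; \<And>x. x \<in> \<Gamma> t1 \<Longrightarrow> has_type \<Gamma> (e2 x) t2\<rbrakk>
    \<Longrightarrow> has_type \<Gamma> (TLet e1 e2) t2"

definition Tm :: "(ty \<Rightarrow> 'v set) \<Rightarrow> ty \<Rightarrow> ('f, 'v) tm set" where
  "Tm \<Gamma> t = {e. has_type \<Gamma> e t}"


section \<open>Indexed administrative normal form\<close>

datatype var = X (var_ty: ty) nat
datatype par = I (par_ty: ty) nat
datatype vpar = AVar var | APar par

fun vpar_ty :: "vpar \<Rightarrow> ty" where
  "vpar_ty (AVar x) = var_ty x"
| "vpar_ty (APar i) = par_ty i"

definition Var :: "ty \<Rightarrow> var set" where "Var t = {x. var_ty x = t}"
definition Par :: "ty \<Rightarrow> par set" where "Par t = {i. par_ty i = t}"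
definition VPar :: "ty \<Rightarrow> vpar set" where "VPar t = AVar ` Var t \<union> APar ` Par t"

datatype 'f prim =
    PAtom vpar
  | PConst "'f const" "vpar list"
  | PFun par vpar
  | PFor par vpar
  | PIte vpar vpar vpar

inductive prim_has_type :: "'f prim \<Rightarrow> ty \<Rightarrow> bool" where
  "v \<in> VPar t \<Longrightarrow> prim_has_type (PAtom v) t"
| "\<lbrakk>const_typing c ts t'; list_all2 (\<lambda>v t. v \<in> VPar t) vs ts\<rbrakk>
    \<Longrightarrow> prim_has_type (PConst c vs) t'"
| "\<lbrakk>i \<in> Par t1; v \<in> VPar t2\<rbrakk> \<Longrightarrow> prim_has_type (PFun i v) (Arrow t1 t2)"
| "\<lbrakk>i \<in> Par (Fin n); v \<in> VPar t\<rbrakk> \<Longrightarrow> prim_has_type (PFor i v) (Array n t)"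
| "\<lbrakk>v1 \<in> VPar (Fin 2); v2 \<in> VPar t; v3 \<in> VPar t\<rbrakk> \<Longrightarrow> prim_has_type (PIte v1 v2 v3) t"

definition Prim :: "ty \<Rightarrow> 'f prim set" where
  "Prim t = {p. prim_has_type p t}"

datatype entry =
    EFun par ty
  | EFor par nat
  | EIfNonzero vpar
  | EIfZero vpar

fun entry_ok :: "entry \<Rightarrow> bool" where
  "entry_ok (EFun i t) \<longleftrightarrow> i \<in> Par t"
| "entry_ok (EFor i n) \<longleftrightarrow> i \<in> Par (Fin n)"
| "entry_ok (EIfNonzero v) \<longleftrightarrow> v \<in> VPar (Fin 2)"
| "entry_ok (EIfZero v) \<longleftrightarrow> v \<in> VPar (Fin 2)"

text \<open>Scope contexts are lists whose last element is the innermost entry.\<close>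

definition Env :: "entry list set" where
  "Env = {C. \<forall>E \<in> set C. entry_ok E}"

text \<open>\<open>ALet C x p a\<close> is \<open>let C[x = p]; a\<close>.\<close>

datatype 'f ainf =
    Ret vpar
  | ALet "entry list" var "'f prim" "'f ainf"

inductive_set AINF :: "ty \<Rightarrow> 'f ainf set" for t :: ty where
  Ret: "v \<in> VPar t \<Longrightarrow> Ret v \<in> AINF t"
| Let: "\<lbrakk>C \<in> Env; x \<in> Var t1; p \<in> Prim t1; a \<in> AINF t\<rbrakk> \<Longrightarrow> ALet C x p a \<in> AINF t"


section \<open>Translation\<close>

type_synonym 'a counter = "nat \<Rightarrow> 'a"

text \<open>
  Smart binding. The argument \<open>t\<close> is the type index of the primitive; it determines the tag
  of the fresh variable.
\<close>

fun smart_bind :: "entry list \<Rightarrow> ty \<Rightarrow> 'f prim \<Rightarrow> (vpar \<Rightarrow> 'f ainf counter) \<Rightarrow> 'f ainf counter" where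
  "smart_bind C t (PAtom v) k m = k v m"
| "smart_bind C t p k m = ALet C (X t m) p (k (AVar (X t m)) (m + 1))"

text \<open>
  The recursive equations are deliberately given without a termination proof: the predicate
  \<open>translate_translate_args_dom\<close> generated here holds of exactly those inputs from which there is no
  infinite chain of recursive calls. Inputs of \<open>translate\<close> and \<open>translate_args\<close> are injected
  into it by \<open>Inl\<close> and \<open>Inr\<close>. The function \<open>translate_args\<close> translates the arguments of a
  constant from left to right and passes the list of resulting atoms to the continuation.
\<close>

function (domintros)
  translate :: "entry list \<Rightarrow> ('f, vpar) tm \<Rightarrow> (vpar \<Rightarrow> 'f ainf counter) \<Rightarrow> 'f ainf counter"
and
  translate_args :: "entry list \<Rightarrow> ('f, vpar) tm list \<Rightarrow> (vpar list \<Rightarrow> 'f ainf counter)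
    \<Rightarrow> 'f ainf counter"
where
  "translate C (TVar v) k m = smart_bind C (vpar_ty v) (PAtom v) k m"
| "translate C (TConst c es) k m =
    translate_args C es (\<lambda>vs. smart_bind C (const_res c) (PConst c vs) k) m"
| "translate C (TFun t e) k m =
    translate (C @ [EFun (I t m) t]) (e (APar (I t m)))
      (\<lambda>v. smart_bind C (Arrow t (vpar_ty v)) (PFun (I t m) v) k) (m + 1)"
| "translate C (TFor n e) k m =
    translate (C @ [EFor (I (Fin n) m) n]) (e (APar (I (Fin n) m)))
      (\<lambda>v. smart_bind C (Array n (vpar_ty v)) (PFor (I (Fin n) m) v) k) (m + 1)"
| "translate C (TIte e1 e2 e3) k m =
    translate C e1 (\<lambda>v1 m1.
      translate (C @ [EIfNonzero v1]) e2 (\<lambda>v2 m2.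
        translate (C @ [EIfZero v1]) e3 (\<lambda>v3.
          smart_bind C (vpar_ty v2) (PIte v1 v2 v3) k) m2) m1) m"
| "translate C (TLet e1 e2) k m = translate C e1 (\<lambda>v1 m1. translate C (e2 v1) k m1) m"
| "translate_args C [] k m = k [] m"
| "translate_args C (e # es) k m =
    translate C e (\<lambda>v m1. translate_args C es (\<lambda>vs. k (v # vs)) m1) m"
  by pat_completeness auto

definition toAINF :: "('f, vpar) tm \<Rightarrow> 'f ainf" where
  "toAINF e = translate [] e (\<lambda>v m. Ret v) 0"

end

theory Submission
  imports Defs
begin

text \<open>
  The recursive calls hidden in continuations are made for all possible atoms and counters, but
  always on an immediate subterm (for binders: on some value of the body). Hence termination is
  structural induction on the term, for all contexts, continuations and counters at once. For
  typing, the invariant is that a continuation sending atoms of the type of the translated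
  term into \<open>AINF t\<close> makes the whole translation land in \<open>AINF t\<close>.
\<close>

text \<open>Covers the recursion nested in argument lists. The tail is called from inside a
  continuation at an arbitrary counter, so the induction varies \<open>k\<close> and
  \<open>m\<close>.\<close>

lemma translate_args_dom:
  assumes "\<And>e C k m. e \<in> set es \<Longrightarrow> translate_translate_args_dom (Inl (C, e, k, m))"
  shows "translate_translate_args_dom (Inr (C, es, k, m))"
  using assms
  by (induction es arbitrary: C k m) (auto intro: translate_translate_args.domintros)

lemma translate_dom: "translate_translate_args_dom (Inl (C, e, k, m))"
  by (induction e arbitrary: C k m)
    (auto intro!: translate_translate_args.domintros translate_args_dom)

termination translate
  by (auto simp: split_sum_all translate_dom translate_args_dom)

text \<open>Links the tags computed by \<open>translate\<close> to the indices in the typing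
  rules.\<close>

lemma mem_VPar_iff: "v \<in> VPar t \<longleftrightarrow> vpar_ty v = t"
  by (cases v) (auto simp: VPar_def Var_def Par_def)

lemma smart_bind_in_AINF:
  assumes "C \<in> Env" "p \<in> Prim t1" "\<And>v m. v \<in> VPar t1 \<Longrightarrow> k v m \<in> AINF t2"
  shows "smart_bind C t1 p k m \<in> AINF t2"
proof -
  \<comment> \<open>The fresh variable has tag \<open>t1\<close>, so the hypothesis on
    \<open>k\<close> applies to it.\<close>
  have "ALet C (X t1 m) p (k (AVar (X t1 m)) (m + 1)) \<in> AINF t2"
    using assms by (auto intro!: AINF.Let simp: Var_def mem_VPar_iff)
  moreover have "k v m \<in> AINF t2" if "p = PAtom v" for v
    using assms that by (auto simp: Prim_def elim: prim_has_type.cases)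
  ultimately show ?thesis
    by (cases p) auto
qed

lemma Env_append: "C @ [E] \<in> Env \<longleftrightarrow> C \<in> Env \<and> entry_ok E"
  by (auto simp: Env_def)

text \<open>The premise on \<open>es\<close> is the invariant itself instead of a typing judgement,
  to match the induction hypothesis for constants.\<close>

lemma translate_args_in_AINF:
  assumes "list_all2 (\<lambda>e t1. \<forall>C k m. C \<in> Env \<longrightarrow> (\<forall>v m. v \<in> VPar t1 \<longrightarrow> k v m \<in> AINF t2)
      \<longrightarrow> translate C e k m \<in> AINF t2) es ts"
    and "C \<in> Env"
    and "\<And>vs m. list_all2 (\<lambda>v t. v \<in> VPar t) vs ts \<Longrightarrow> k vs m \<in> AINF t2"
  shows "translate_args C es k m \<in> AINF t2"
  using assms
proof (induction es ts arbitrary: k m rule: list_all2_induct)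
  case Nil
  then show ?case by simp
next
  case (Cons e es t1 ts)
  have "translate_args C es (\<lambda>vs. k (v # vs)) m1 \<in> AINF t2" if "v \<in> VPar t1" for v m1
    using that Cons.prems by (intro Cons.IH) auto
  then show ?case
    using Cons.hyps Cons.prems by simp
qed

lemma translate_in_AINF:
  assumes "has_type VPar e t1" "C \<in> Env" "\<And>v m. v \<in> VPar t1 \<Longrightarrow> k v m \<in> AINF t2"
  shows "translate C e k m \<in> AINF t2"
  using assms
proof (induction e t1 arbitrary: C k m rule: has_type.induct)
  case (Var x t)
  then show ?case by simp
next
  case (Const c ts t' es)
  have "smart_bind C (const_res c) (PConst c vs) k m1 \<in> AINF t2"
    if "list_all2 (\<lambda>v t. v \<in> VPar t) vs ts" for vs m1
    using that Const.hyps Const.prems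
    by (intro smart_bind_in_AINF)
      (auto simp: Prim_def const_typing_def intro!: prim_has_type.intros)
  moreover have "list_all2 (\<lambda>e t1. \<forall>C k m. C \<in> Env
      \<longrightarrow> (\<forall>v m. v \<in> VPar t1 \<longrightarrow> k v m \<in> AINF t2) \<longrightarrow> translate C e k m \<in> AINF t2) es ts"
    using Const.IH by (rule list_all2_mono) blast
  ultimately show ?case
    using Const.prems by (auto intro: translate_args_in_AINF)
next
  case (Fun t1 e t)
  have "smart_bind C (Arrow t1 (vpar_ty v)) (PFun (I t1 m) v) k m1 \<in> AINF t2"
    if "v \<in> VPar t" for v m1
    using that Fun.prems
    by (intro smart_bind_in_AINF)
      (auto simp: Prim_def Par_def mem_VPar_iff intro!: prim_has_type.intros)
  \<comment> \<open>The fresh index lies in \<open>VPar t1\<close>, where the body is known to be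
    typed.\<close>
  then show ?case
    using Fun.prems by (auto intro!: Fun.IH simp: Env_append Par_def mem_VPar_iff)
next
  case (For n e t)
  have "smart_bind C (Array n (vpar_ty v)) (PFor (I (Fin n) m) v) k m1 \<in> AINF t2"
    if "v \<in> VPar t" for v m1
    using that For.prems
    by (intro smart_bind_in_AINF)
      (auto simp: Prim_def Par_def mem_VPar_iff intro!: prim_has_type.intros)
  then show ?case
    using For.prems by (auto intro!: For.IH simp: Env_append Par_def mem_VPar_iff)
next
  case (Ite e1 e2 t e3)
  \<comment> \<open>The tag comes from the first branch; both branches have type
    \<open>t\<close>.\<close>
  have "smart_bind C (vpar_ty v2) (PIte v1 v2 v3) k m1 \<in> AINF t2"
    if "v1 \<in> VPar (Fin 2)" "v2 \<in> VPar t" "v3 \<in> VPar t" for v1 v2 v3 m1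
    using that Ite.prems
    by (intro smart_bind_in_AINF) (auto simp: Prim_def mem_VPar_iff intro!: prim_has_type.intros)
  then show ?case
    using Ite.prems by (auto intro!: Ite.IH simp: Env_append)
next
  case (Let e1 t1 e2 t)
  \<comment> \<open>Atoms passed on by \<open>e1\<close> lie in \<open>VPar t1\<close>, so the
    hypothesis for \<open>e2\<close> applies to them.\<close>
  then show ?case by simp
qed

theorem theorem2:
  shows "(\<forall>C (e :: ('f, vpar) tm) k m. translate_translate_args_dom (Inl (C, e, k, m))) \<and>
    (\<forall>C (es :: ('f, vpar) tm list) k m. translate_translate_args_dom (Inr (C, es, k, m))) \<and>
    (\<forall>t. \<forall>e \<in> (Tm VPar t :: ('f, vpar) tm set). toAINF e \<in> AINF t)"
  by (auto simp: toAINF_def Tm_def Env_def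
      intro: translate_dom translate_args_dom translate_in_AINF AINF.Ret)

end
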